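(* Let $p,h,k$ be positive integers. There is a bijection between $\mathcal P_{(p,h,k)}=\bigcup_{\beta\in I_{(h,k)}}\mathcal P_{(p,h,k),\beta}$ and the set of stable monomial ideals $J\triangleleft\mathbf k[x_1,x_2,x_3]$ with $\mathsf N(J)$ finite whose Bar Code of $\mathsf N(J)$ has bar list $(p,h,k)$.
   Context: $\mathbf k$ is a field of characteristic $0$; terms ordered lexicographically with $x_1<x_2<x_3$. A monomial ideal $J$ is stable if for every term $\tau\in J$ and every variable $x_j>\min(\tau)$ (smallest variable dividing $\tau$), $x_j\tau/\min(\tau)\in J$; $\mathsf N(J)$ is the set of terms not in $J$. The bar list of (the Bar Code of) a finite set $M$ of terms is $(\mu(1),\mu(2),\mu(3))$ with $\mu(1)=|M|$, $\mu(2)=|\{x_2^{\gamma_2}x_3^{\gamma_3}: x^\gamma\in M\}|$, $\mu(3)=|\{x_3^{\gamma_3}:x^\gamma\in M\}|$. $I_{(h,k)}$ is the set of $(\beta_1,\dots,\beta_k)\in\mathbb N^k$ with $\beta_1>\dots>\beta_k>0$, $\sum\beta_i=h$. For $\beta\in I_{(h,k)}$, $\mathcal P_{(p,h,k),\beta}$ is the set of integer arrays $\rho=(\rho_{i,j})_{1\le i\le k,\,1\le j\le\beta_i}$ (row- and column-strict plane partitions of shape $\beta$) with $\rho_{i,j}>0$, $\rho_{i,j}>\rho_{i,j+1}$ for $j<\beta_i$, $\rho_{i,j}>\rho_{i+1,j}$ for $i<k$, $j\le\beta_{i+1}$, and $\sum_{i,j}\rho_{i,j}=p$. *)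

theory Defs
  imports Complex_Main "HOL-Library.Poly_Mapping"
begin

section \<open>Terms and polynomials in three variables\<close>

datatype var = X1 | X2 | X3

primrec var_index :: "var \<Rightarrow> nat" where
  "var_index X1 = 1"
| "var_index X2 = 2"
| "var_index X3 = 3"

instantiation var :: linorder
begin

definition less_eq_var :: "var \<Rightarrow> var \<Rightarrow> bool" where
  "x \<le> y \<longleftrightarrow> var_index x \<le> var_index y"

definition less_var :: "var \<Rightarrow> var \<Rightarrow> bool" where
  "x < y \<longleftrightarrow> var_index x < var_index y"

instance
proof
  fix x y :: var
  show "x \<le> y \<Longrightarrow> y \<le> x \<Longrightarrow> x = y"
    by (cases x; cases y) (simp_all add: less_eq_var_def)
qed (auto simp: less_eq_var_def less_var_def)

end

text \<open>A term is given by its exponent vector, so the product of two terms is the sum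
  of the exponent vectors and the term 1 is \<open>0\<close>. Polynomials are the finitely
  supported functions from terms to coefficients, with convolution as product.\<close>

type_synonym pterm = "var \<Rightarrow>\<^sub>0 nat"
type_synonym 'k polynomial3 = "pterm \<Rightarrow>\<^sub>0 'k"

definition term_poly :: "pterm \<Rightarrow> 'k::field_char_0 polynomial3" where
  "term_poly t = Poly_Mapping.single t 1"

definition var_term :: "var \<Rightarrow> pterm" where
  "var_term x = Poly_Mapping.single x 1"

section \<open>Stable monomial ideals\<close>

text \<open>Ideals are the submodules of the ring regarded as a module over itself.\<close>

lemma module_mult: "module ((*) :: 'a::comm_ring_1 \<Rightarrow> 'a \<Rightarrow> 'a)"
  by unfold_locales (simp_all add: algebra_simps)

definition monomial_ideal :: "'k::field_char_0 polynomial3 set \<Rightarrow> bool" where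
  "monomial_ideal J \<longleftrightarrow> (\<exists>G. J = module.span (*) (term_poly ` G))"

definition min_var :: "pterm \<Rightarrow> var" where
  "min_var t = Min (Poly_Mapping.keys t)"

text \<open>The term 1 is divisible by no variable, so no condition is imposed on it. Since
  \<open>min_var t\<close> divides \<open>t\<close>, the subtraction below is the exact quotient.\<close>

definition stable :: "'k::field_char_0 polynomial3 set \<Rightarrow> bool" where
  "stable J \<longleftrightarrow>
     (\<forall>t x. term_poly t \<in> J \<and> t \<noteq> 0 \<and> min_var t < x \<longrightarrow>
        term_poly (var_term x + t - var_term (min_var t)) \<in> J)"

definition terms_outside :: "'k::field_char_0 polynomial3 set \<Rightarrow> pterm set" where
  "terms_outside J = {t. term_poly t \<notin> J}"

section \<open>Bar lists\<close>

definition bar_list :: "pterm set \<Rightarrow> nat \<times> nat \<times> nat" where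
  "bar_list M =
     (card M,
      card ((\<lambda>t. Poly_Mapping.single X2 (Poly_Mapping.lookup t X2)
               + Poly_Mapping.single X3 (Poly_Mapping.lookup t X3)) ` M),
      card ((\<lambda>t. Poly_Mapping.single X3 (Poly_Mapping.lookup t X3)) ` M))"

section \<open>Row- and column-strict plane partitions\<close>

text \<open>Tuples and arrays are indexed from 1 and extended by zero outside their index
  range. As all entries in range are positive, an array determines its shape.\<close>

definition strict_shapes :: "nat \<Rightarrow> nat \<Rightarrow> (nat \<Rightarrow> nat) set" where
  "strict_shapes h k =
     {\<beta>. (\<forall>i. i \<notin> {1..k} \<longrightarrow> \<beta> i = 0) \<and>
         (\<forall>i\<in>{1..k}. \<beta> i > 0) \<and>
         (\<forall>i\<in>{1..<k}. \<beta> i > \<beta> (i + 1)) \<and>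
         (\<Sum>i=1..k. \<beta> i) = h}"

definition strict_plane_partitions_of_shape ::
    "nat \<Rightarrow> nat \<Rightarrow> (nat \<Rightarrow> nat) \<Rightarrow> (nat \<Rightarrow> nat \<Rightarrow> int) set" where
  "strict_plane_partitions_of_shape p k \<beta> =
     {\<rho>. (\<forall>i j. \<not> (i \<in> {1..k} \<and> j \<in> {1..\<beta> i}) \<longrightarrow> \<rho> i j = 0) \<and>
         (\<forall>i\<in>{1..k}. \<forall>j\<in>{1..\<beta> i}. \<rho> i j > 0) \<and>
         (\<forall>i\<in>{1..k}. \<forall>j\<in>{1..<\<beta> i}. \<rho> i j > \<rho> i (j + 1)) \<and>
         (\<forall>i\<in>{1..<k}. \<forall>j\<in>{1..\<beta> (i + 1)}. \<rho> i j > \<rho> (i + 1) j) \<and>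
         (\<Sum>i=1..k. \<Sum>j=1..\<beta> i. \<rho> i j) = int p}"

definition strict_plane_partitions ::
    "nat \<Rightarrow> nat \<Rightarrow> nat \<Rightarrow> (nat \<Rightarrow> nat \<Rightarrow> int) set" where
  "strict_plane_partitions p h k =
     (\<Union>\<beta>\<in>strict_shapes h k. strict_plane_partitions_of_shape p k \<beta>)"

end

theory Submission
  imports Defs
begin

text \<open>A finite set of terms closed under divisors is a staircase: it is given by the numbers
  \<open>r c b\<close> of exponents \<open>a\<close> for which it contains \<open>x\<^sub>1\<^sup>a x\<^sub>2\<^sup>b x\<^sub>3\<^sup>c\<close>. Stability for \<open>\<tau>\<close> with
  \<open>min(\<tau>) = x\<^sub>1\<close> says exactly that \<open>r\<close> is strictly decreasing in both directions as long as it
  is positive; for \<open>min(\<tau>) = x\<^sub>2\<close> it says that the lengths of the rows of the support strictly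
  decrease. So \<open>r\<close> is a strict plane partition (with indices starting from 0), and the bar list
  records its sum, the size of its support and its number of rows.\<close>

section \<open>Monomial ideals and their sets of terms\<close>

interpretation poly: module "(*) :: 'k::field_char_0 polynomial3 \<Rightarrow> 'k polynomial3 \<Rightarrow> 'k polynomial3"
  by (rule module_mult)

definition monomial_span :: "pterm set \<Rightarrow> 'k::field_char_0 polynomial3 set" where
  "monomial_span G = module.span (*) (term_poly ` G)"

definition terms_in :: "'k::field_char_0 polynomial3 set \<Rightarrow> pterm set" where
  "terms_in J = {t. term_poly t \<in> J}"

text \<open>Terms multiply by adding exponents, so these are the semigroup ideals of the monoid of
  terms.\<close>

definition up_closed :: "pterm set \<Rightarrow> bool" where
  "up_closed G \<longleftrightarrow> (\<forall>t\<in>G. \<forall>s. s + t \<in> G)"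

lemma term_poly_add: "term_poly (s + t) = term_poly s * (term_poly t :: 'k::field_char_0 polynomial3)"
  by (simp add: term_poly_def mult_single)

text \<open>Up-closure makes the polynomials supported in \<open>G\<close> an ideal, because every
  key of a product is a sum of keys of the factors. This ideal contains the generators, hence the
  span, so no term outside \<open>G\<close> can enter the span.\<close>

lemma terms_in_monomial_span:
  assumes "up_closed G"
  shows "terms_in (monomial_span G :: 'k::field_char_0 polynomial3 set) = G"
proof -
  let ?S = "{f :: 'k polynomial3. Poly_Mapping.keys f \<subseteq> G}"
  have "poly.subspace ?S"
  proof (rule poly.subspaceI)
    fix f g :: "'k polynomial3"
    assume "f \<in> ?S" "g \<in> ?S"
    then show "f + g \<in> ?S"
      using keys_add[of f g] by auto
  next
    fix c f :: "'k polynomial3"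
    assume "f \<in> ?S"
    then show "c * f \<in> ?S"
      using keys_mult[of c f] assms unfolding up_closed_def by blast
  qed simp
  moreover have "term_poly ` G \<subseteq> ?S"
    by (auto simp: term_poly_def)
  ultimately have "monomial_span G \<subseteq> ?S"
    unfolding monomial_span_def by (rule poly.span_minimal[rotated])
  then show ?thesis
    by (auto simp: terms_in_def monomial_span_def term_poly_def intro: poly.span_base)
qed

text \<open>The generators are themselves terms of \<open>J\<close>, so the terms of
  \<open>J\<close> already span it. With the preceding lemma, monomial ideals correspond bijectively
  to up-closed sets of terms.\<close>

lemma
  assumes "monomial_ideal J"
  shows up_closed_terms_in: "up_closed (terms_in J)"
    and monomial_span_terms_in: "monomial_span (terms_in J) = J"
proof -
  from assms obtain G where J: "J = poly.span (term_poly ` G)"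
    by (auto simp: monomial_ideal_def)
  show "up_closed (terms_in J)"
    by (auto simp: up_closed_def terms_in_def term_poly_add J intro: poly.span_scale)
  have "term_poly ` G \<subseteq> term_poly ` terms_in J"
    by (auto simp: terms_in_def J intro: poly.span_base)
  then have "J \<subseteq> monomial_span (terms_in J)"
    unfolding monomial_span_def by (subst J) (rule poly.span_mono)
  moreover have "monomial_span (terms_in J) \<subseteq> J"
    unfolding monomial_span_def
    by (rule poly.span_minimal) (auto simp: terms_in_def J)
  ultimately show "monomial_span (terms_in J) = J"
    by blast
qed

lemma monomial_ideal_monomial_span: "monomial_ideal (monomial_span G)"
  by (auto simp: monomial_ideal_def monomial_span_def)

lemma terms_outside_eq: "terms_outside J = - terms_in J"
  by (auto simp: terms_outside_def terms_in_def)

section \<open>Staircases\<close>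

definition monom3 :: "nat \<Rightarrow> nat \<Rightarrow> nat \<Rightarrow> pterm" where
  "monom3 a b c = Poly_Mapping.single X1 a + Poly_Mapping.single X2 b + Poly_Mapping.single X3 c"

lemma lookup_monom3 [simp]:
  "Poly_Mapping.lookup (monom3 a b c) X1 = a" "Poly_Mapping.lookup (monom3 a b c) X2 = b" "Poly_Mapping.lookup (monom3 a b c) X3 = c"
  by (simp_all add: monom3_def lookup_add lookup_single)

lemma pterm_eq_iff:
  fixes s t :: pterm
  shows "s = t \<longleftrightarrow> Poly_Mapping.lookup s X1 = Poly_Mapping.lookup t X1 \<and> Poly_Mapping.lookup s X2 = Poly_Mapping.lookup t X2 \<and> Poly_Mapping.lookup s X3 = Poly_Mapping.lookup t X3"
proof
  assume "Poly_Mapping.lookup s X1 = Poly_Mapping.lookup t X1 \<and> Poly_Mapping.lookup s X2 = Poly_Mapping.lookup t X2 \<and> Poly_Mapping.lookup s X3 = Poly_Mapping.lookup t X3"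
  then have "Poly_Mapping.lookup s x = Poly_Mapping.lookup t x" for x
    by (cases x) auto
  then show "s = t"
    by (rule poly_mapping_eqI)
qed simp

lemma pterm_cases:
  obtains a b c where "t = monom3 a b c"
  using that[of "Poly_Mapping.lookup t X1" "Poly_Mapping.lookup t X2" "Poly_Mapping.lookup t X3"]
  by (simp add: pterm_eq_iff)

text \<open>The exponent of \<open>X3\<close> comes first: it will be the row index of the plane
  partition, and the exponent of \<open>X2\<close> the column index.\<close>

definition staircase :: "(nat \<Rightarrow> nat \<Rightarrow> nat) \<Rightarrow> pterm set" where
  "staircase r = {t. Poly_Mapping.lookup t X1 < r (Poly_Mapping.lookup t X3) (Poly_Mapping.lookup t X2)}"

definition cells :: "(nat \<Rightarrow> nat \<Rightarrow> nat) \<Rightarrow> (nat \<times> nat) set" where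
  "cells r = {(c, b). r c b > 0}"

lemma monom3_in_staircase [simp]: "monom3 a b c \<in> staircase r \<longleftrightarrow> a < r c b"
  by (simp add: staircase_def)

lemma staircase_eq_image:
  "staircase r = (\<lambda>((c, b), a). monom3 a b c) ` (SIGMA (c, b):cells r. {..<r c b})"
proof (rule set_eqI)
  fix t
  obtain a b c where t: "t = monom3 a b c"
    by (rule pterm_cases)
  show "t \<in> staircase r \<longleftrightarrow>
      t \<in> (\<lambda>((c, b), a). monom3 a b c) ` (SIGMA (c, b):cells r. {..<r c b})"
    unfolding t by (auto simp: cells_def image_iff pterm_eq_iff)
qed

text \<open>A stack of positive height contains its bottom term, the one with exponent 0 at
  \<open>X1\<close>. The projections counted by the bar list can thus be read off from the
  cells.\<close>

lemma cells_eq_image: "cells r = (\<lambda>t. (Poly_Mapping.lookup t X3, Poly_Mapping.lookup t X2)) ` staircase r"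
proof (intro set_eqI iffI)
  fix x
  assume "x \<in> cells r"
  then obtain c b where "x = (c, b)" "monom3 0 b c \<in> staircase r"
    by (auto simp: cells_def)
  then show "x \<in> (\<lambda>t. (Poly_Mapping.lookup t X3, Poly_Mapping.lookup t X2)) ` staircase r"
    by (intro image_eqI[where x = "monom3 0 b c"]) simp_all
qed (auto simp: cells_def staircase_def)

lemma inj_staircase: "inj staircase"
proof (rule injI, intro ext)
  fix r s c b
  assume "staircase r = staircase s"
  then have "a < r c b \<longleftrightarrow> a < s c b" for a
    by (metis monom3_in_staircase)
  then show "r c b = s c b"
    by (metis linorder_neqE_nat less_irrefl)
qed

lemma finite_staircase_iff: "finite (staircase r) \<longleftrightarrow> finite (cells r)"
proof
  show "finite (staircase r)" if "finite (cells r)"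
    unfolding staircase_eq_image using that by (intro finite_imageI finite_SigmaI) auto
qed (simp add: cells_eq_image)

lemma bar_list_staircase:
  assumes "finite (cells r)"
  shows "bar_list (staircase r) = (\<Sum>(c, b)\<in>cells r. r c b, card (cells r), card (fst ` cells r))"
proof -
  have "card (staircase r) = card (SIGMA (c, b):cells r. {..<r c b})"
    unfolding staircase_eq_image by (rule card_image) (auto simp: inj_on_def pterm_eq_iff)
  also have "\<dots> = (\<Sum>(c, b)\<in>cells r. r c b)"
    using assms by (subst card_SigmaI) (auto simp: case_prod_beta)
  finally have 1: "card (staircase r) = (\<Sum>(c, b)\<in>cells r. r c b)" .
  have "(\<lambda>t. Poly_Mapping.single X2 (Poly_Mapping.lookup t X2) + Poly_Mapping.single X3 (Poly_Mapping.lookup t X3)) ` staircase r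
      = (\<lambda>(c, b). monom3 0 b c) ` cells r"
    unfolding cells_eq_image by (simp add: image_image monom3_def)
  moreover have "card ((\<lambda>(c, b). monom3 0 b c) ` cells r) = card (cells r)"
    by (rule card_image) (auto simp: inj_on_def pterm_eq_iff)
  moreover have "(\<lambda>t. Poly_Mapping.single X3 (Poly_Mapping.lookup t X3)) ` staircase r
      = (\<lambda>c. monom3 0 0 c) ` fst ` cells r"
    unfolding cells_eq_image by (simp add: image_image monom3_def)
  moreover have "card ((\<lambda>c. monom3 0 0 c) ` fst ` cells r) = card (fst ` cells r)"
    by (rule card_image) (auto simp: inj_on_def pterm_eq_iff)
  ultimately show ?thesis
    using 1 by (simp add: bar_list_def)
qed

text \<open>Nothing from the least missing number on can belong to \<open>S\<close>. This serves for
  the exponents of \<open>X1\<close> over one cell and, later, for the support of each row and the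
  set of nonempty rows.\<close>

lemma down_closed_eq_lessThan:
  fixes S :: "nat set"
  assumes "finite S" and down: "\<And>n. Suc n \<in> S \<Longrightarrow> n \<in> S"
  shows "S = {..<card S}"
proof -
  define m where "m = (LEAST n. n \<notin> S)"
  have "\<exists>n. n \<notin> S"
    using ex_new_if_finite[OF infinite_UNIV_nat assms(1)] .
  then have "m \<notin> S"
    unfolding m_def by (rule LeastI_ex)
  have "n \<notin> S" if "m \<le> n" for n
    using that \<open>m \<notin> S\<close> by (induction n rule: dec_induct) (auto dest: down)
  moreover have "n \<in> S" if "n < m" for n
    using not_less_Least[of n "\<lambda>n. n \<notin> S"] that by (auto simp: m_def)
  ultimately have "S = {..<m}"
    by (auto simp: not_less[symmetric])
  then show ?thesis
    by simp
qed

text \<open>Over each cell the exponents of \<open>X1\<close> outside \<open>U\<close> form a finite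
  set closed under predecessors, since multiplying by \<open>X1\<close> cannot leave
  \<open>U\<close>. Its cardinality is the height.\<close>

lemma ex_staircase:
  assumes "up_closed U" and "finite (- U)"
  shows "\<exists>r. - U = staircase r"
proof -
  define r where "r c b = card {a. monom3 a b c \<in> - U}" for c b
  have "{a. monom3 a b c \<in> - U} = {..<r c b}" for b c
    unfolding r_def
  proof (rule down_closed_eq_lessThan)
    have "inj (\<lambda>a. monom3 a b c)"
      by (auto simp: inj_def pterm_eq_iff)
    from finite_vimageI[OF assms(2) this] show "finite {a. monom3 a b c \<in> - U}"
      by (simp add: vimage_def)
  next
    fix a
    have "monom3 (Suc a) b c = monom3 1 0 0 + monom3 a b c"
      by (simp add: pterm_eq_iff lookup_add)
    then show "a \<in> {a. monom3 a b c \<in> - U}" if "Suc a \<in> {a. monom3 a b c \<in> - U}"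
      using that assms(1) by (auto simp: up_closed_def)
  qed
  then have "monom3 a b c \<in> - U \<longleftrightarrow> monom3 a b c \<in> staircase r" for a b c
    by auto
  then have "t \<in> - U \<longleftrightarrow> t \<in> staircase r" for t
    by (metis pterm_cases)
  then show ?thesis
    by blast
qed

section \<open>Strict heights\<close>

text \<open>Truncated subtraction makes \<open>r c (Suc b) \<le> r c b - 1\<close> a strict decrease where
  \<open>r c b > 0\<close> and propagates the value 0. The last condition makes the rows of the
  support strictly shorter.\<close>

definition strict_heights :: "(nat \<Rightarrow> nat \<Rightarrow> nat) \<Rightarrow> bool" where
  "strict_heights r \<longleftrightarrow> (\<forall>c b. r c (Suc b) \<le> r c b - 1 \<and> r (Suc c) b \<le> r c b - 1 \<and>
     (r c (Suc b) = 0 \<longrightarrow> r (Suc c) b = 0))"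

text \<open>The intermediate set through which the bijection factors. The triple is the bar list of
  \<open>staircase r\<close>, by \<open>bar_list_staircase\<close>.\<close>

definition heights_of :: "nat \<Rightarrow> nat \<Rightarrow> nat \<Rightarrow> (nat \<Rightarrow> nat \<Rightarrow> nat) set" where
  "heights_of p h k = {r. strict_heights r \<and> finite (cells r) \<and>
     ((\<Sum>(c, b)\<in>cells r. r c b), card (cells r), card (fst ` cells r)) = (p, h, k)}"

text \<open>Multiplying a term raises its exponent of \<open>X1\<close> weakly and moves it to a
  cell of at most the same height, so it stays outside the staircase.\<close>

lemma up_closed_compl_staircase:
  assumes "strict_heights r"
  shows "up_closed (- staircase r)"
proof -
  have dec: "r c (Suc b) \<le> r c b" "r (Suc c) b \<le> r c b" for c b
    using assms unfolding strict_heights_def by (meson diff_le_self le_trans)+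
  have 1: "r c (b' + b) \<le> r c b" for c b b'
    by (induction b') (auto intro: order_trans[OF dec(1)])
  have 2: "r (c' + c) b \<le> r c b" for c c' b
    by (induction c') (auto intro: order_trans[OF dec(2)])
  have "r (c' + c) (b' + b) \<le> r c b" for c c' b b'
    using 1[of "c' + c" b' b] 2[of c' c b] by linarith
  then have "s + t \<notin> staircase r" if "t \<notin> staircase r" for s t
    using that unfolding staircase_def lookup_add mem_Collect_eq not_less
    by (meson order_trans trans_le_add2)
  then show ?thesis
    by (simp add: up_closed_def)
qed

section \<open>Stability of the ideal as strictness of the heights\<close>

lemma min_var_eqI:
  assumes "Poly_Mapping.lookup t x > 0" and "\<And>y. y < x \<Longrightarrow> Poly_Mapping.lookup t y = 0"
  shows "min_var t = x"
  unfolding min_var_def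
proof (rule Min_eqI)
  fix y
  assume "y \<in> Poly_Mapping.keys t"
  then show "x \<le> y"
    using assms(2)[of y] by (auto simp: in_keys_iff not_less[symmetric])
qed (use assms(1) in \<open>simp_all add: in_keys_iff\<close>)

lemma min_var_monom3:
  "min_var (monom3 (Suc a) b c) = X1"
  "min_var (monom3 0 (Suc b) c) = X2"
  "min_var (monom3 0 0 (Suc c)) = X3"
proof -
  have "y < X1 \<Longrightarrow> P" "y < X2 \<Longrightarrow> y = X1" "y < X3 \<Longrightarrow> y = X1 \<or> y = X2" for y P
    by (cases y; simp add: less_var_def)+
  then show "min_var (monom3 (Suc a) b c) = X1" "min_var (monom3 0 (Suc b) c) = X2"
    "min_var (monom3 0 0 (Suc c)) = X3"
    by (auto intro!: min_var_eqI) (metis lookup_monom3)+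
qed

lemma stable_monomial_span_iff:
  assumes "up_closed (- staircase r)"
  shows "stable (monomial_span (- staircase r) :: 'k::field_char_0 polynomial3 set) \<longleftrightarrow> strict_heights r"
proof -
  have in_iff: "term_poly t \<in> (monomial_span (- staircase r) :: 'k polynomial3 set) \<longleftrightarrow>
      t \<notin> staircase r" for t
    using terms_in_monomial_span[OF assms, where ?'k = 'k] by (auto simp: terms_in_def)
  \<comment> \<open>Writing the exponent of the smallest variable as a successor makes the truncated
    subtraction an exact division.\<close>
  have move:
    "var_term X2 + monom3 (Suc a) b c - var_term X1 = monom3 a (Suc b) c"
    "var_term X3 + monom3 (Suc a) b c - var_term X1 = monom3 a b (Suc c)"
    "var_term X3 + monom3 a (Suc b) c - var_term X2 = monom3 a b (Suc c)" for a b c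
    by (simp_all add: pterm_eq_iff lookup_add lookup_minus var_term_def lookup_single)
  have X_less: "X1 < X2" "X1 < X3" "X2 < X3"
    by (simp_all add: less_var_def)
  have nz: "monom3 (Suc a) b c \<noteq> 0" "monom3 a (Suc b) c \<noteq> 0" for a b c
    by (simp_all add: pterm_eq_iff)
  show ?thesis
  proof
    assume "stable (monomial_span (- staircase r) :: 'k polynomial3 set)"
    then have st: "var_term x + t - var_term (min_var t) \<notin> staircase r"
      if "t \<notin> staircase r" "t \<noteq> 0" "min_var t < x" for t x
      using that by (simp add: stable_def in_iff)
    show "strict_heights r"
      unfolding strict_heights_def
    proof (intro allI conjI impI)
      fix c b
      have s1: "r c (Suc b) \<le> a \<and> r (Suc c) b \<le> a" if "r c b \<le> Suc a" for a
        using st[of "monom3 (Suc a) b c" X2] st[of "monom3 (Suc a) b c" X3] that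
        by (simp add: min_var_monom3 X_less nz move not_less)
      \<comment> \<open>The smallest admissible \<open>a\<close> gives the sharpest bound; for
        \<open>r c b = 0\<close> truncation makes it 0, so zeros propagate.\<close>
      from s1[of "r c b - 1"] show "r c (Suc b) \<le> r c b - 1" "r (Suc c) b \<le> r c b - 1"
        by auto
      show "r (Suc c) b = 0" if "r c (Suc b) = 0"
        using st[of "monom3 0 (Suc b) c" X3] that
        by (simp add: min_var_monom3 X_less nz move)
    qed
  next
    assume str: "strict_heights r"
    have "var_term x + t - var_term (min_var t) \<notin> staircase r"
      if t: "t \<notin> staircase r" "t \<noteq> 0" "min_var t < x" for t x
    proof -
      obtain a b c where abc: "t = monom3 a b c"
        by (rule pterm_cases)
      \<comment> \<open>The cases follow the smallest variable of \<open>t\<close>. For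
        \<open>X3\<close> no larger variable exists, and the last case is the excluded term
        1.\<close>
      consider a' where "a = Suc a'" | b' where "a = 0" "b = Suc b'"
        | c' where "a = 0" "b = 0" "c = Suc c'" | "a = 0" "b = 0" "c = 0"
        by (metis not0_implies_Suc)
      then show ?thesis
      proof cases
        case 1
        have "x = X2 \<or> x = X3"
          using t(3) by (cases x) (auto simp: abc 1 min_var_monom3 less_var_def)
        moreover have "r c (Suc b) \<le> r c b - 1" "r (Suc c) b \<le> r c b - 1"
          using str by (simp_all add: strict_heights_def)
        ultimately show ?thesis
          using t(1) by (auto simp: abc 1 min_var_monom3 move)
      next
        case 2
        have "x = X3"
          using t(3) by (cases x) (auto simp: abc 2 min_var_monom3 less_var_def)
        then show ?thesis
          using t(1) str by (auto simp: abc 2 min_var_monom3 move strict_heights_def)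
      next
        case 3
        then show ?thesis
          using t(3) by (cases x) (auto simp: abc min_var_monom3 less_var_def)
      next
        case 4
        then show ?thesis
          using t(2) by (simp add: abc pterm_eq_iff)
      qed
    qed
    then show "stable (monomial_span (- staircase r) :: 'k polynomial3 set)"
      by (simp add: stable_def in_iff)
  qed
qed

text \<open>Injectivity holds because the terms of the ideal recover the staircase, and the
  staircase its heights. For surjectivity, \<open>ex_staircase\<close> supplies the heights and the
  stability criterion makes them strict.\<close>

lemma bij_betw_heights_ideals:
  "bij_betw (\<lambda>r. monomial_span (- staircase r)) (heights_of p h k)
     {J :: 'k::field_char_0 polynomial3 set.
        monomial_ideal J \<and> stable J \<and> finite (terms_outside J) \<and>
        bar_list (terms_outside J) = (p, h, k)}"
    (is "bij_betw ?f _ ?Js")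
proof (rule bij_betwI')
  fix r s
  assume "r \<in> heights_of p h k" "s \<in> heights_of p h k"
  then have up: "up_closed (- staircase r)" "up_closed (- staircase s)"
    unfolding heights_of_def by (blast intro: up_closed_compl_staircase)+
  show "(?f r = (?f s :: 'k polynomial3 set)) \<longleftrightarrow> r = s"
  proof
    assume "?f r = (?f s :: 'k polynomial3 set)"
    then have "staircase r = staircase s"
      using terms_in_monomial_span[OF up(1), where ?'k = 'k]
        terms_in_monomial_span[OF up(2), where ?'k = 'k] by (metis double_compl)
    then show "r = s"
      using inj_staircase by (simp add: inj_def)
  qed simp
next
  fix r
  assume r: "r \<in> heights_of p h k"
  then have up: "up_closed (- staircase r)"
    unfolding heights_of_def by (blast intro: up_closed_compl_staircase)
  show "?f r \<in> ?Js"
    using r by (auto simp: heights_of_def stable_monomial_span_iff[OF up] terms_outside_eq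
        terms_in_monomial_span[OF up] finite_staircase_iff bar_list_staircase
        monomial_ideal_monomial_span)
next
  fix J :: "'k polynomial3 set"
  assume J: "J \<in> ?Js"
  then have mon: "monomial_ideal J" and fin: "finite (- terms_in J)"
    by (auto simp: terms_outside_eq)
  from ex_staircase[OF up_closed_terms_in[OF mon] fin]
  obtain r where r: "- terms_in J = staircase r"
    by blast
  then have compl: "terms_in J = - staircase r"
    by blast
  have J_eq: "J = ?f r"
    using monomial_span_terms_in[OF mon] by (simp add: compl)
  have "up_closed (- staircase r)"
    using up_closed_terms_in[OF mon] by (simp add: compl)
  from stable_monomial_span_iff[OF this, where ?'k = 'k] J
  have "strict_heights r"
    by (simp add: J_eq)
  moreover have "finite (cells r)"
    using fin by (simp add: r finite_staircase_iff)
  ultimately have "r \<in> heights_of p h k"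
    using J bar_list_staircase[of r] by (simp add: heights_of_def terms_outside_eq r)
  then show "\<exists>r\<in>heights_of p h k. J = ?f r"
    using J_eq by blast
qed

section \<open>Strict plane partitions\<close>

text \<open>Shifts indices from base 0 to base 1. Index 0 is treated separately, as truncated
  \<open>i - 1\<close> would otherwise repeat the first row or column there.\<close>

definition plane_array :: "(nat \<Rightarrow> nat \<Rightarrow> nat) \<Rightarrow> nat \<Rightarrow> nat \<Rightarrow> int" where
  "plane_array r i j = (if i = 0 \<or> j = 0 then 0 else int (r (i - 1) (j - 1)))"

lemma plane_array_Suc [simp]: "plane_array r (Suc c) (Suc b) = int (r c b)"
  by (simp add: plane_array_def)

text \<open>Zeros propagate along rows and down columns, so the support is a left-justified diagram
  whose nonempty rows come first.\<close>

lemma cells_strict_heights: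
  assumes "strict_heights r" "finite (cells r)"
  shows "cells r = (SIGMA c:{..<card (fst ` cells r)}. {..<card {b. r c b > 0}})"
    and "\<And>c b. r c b > 0 \<longleftrightarrow> b < card {b. r c b > 0}"
    and "\<And>c. card {b. r c b > 0} > 0 \<longleftrightarrow> c < card (fst ` cells r)"
proof -
  have row: "{b. r c b > 0} = {..<card {b. r c b > 0}}" for c
  proof (rule down_closed_eq_lessThan)
    have "{b. r c b > 0} = Pair c -` cells r"
      by (auto simp: cells_def)
    then show "finite {b. r c b > 0}"
      using finite_vimageI[OF assms(2), of "Pair c"] by (simp add: inj_def)
    show "Suc b \<in> {b. r c b > 0} \<Longrightarrow> b \<in> {b. r c b > 0}" for b
      using assms(1) unfolding strict_heights_def by (metis mem_Collect_eq diff_0_eq_0 le_zero_eq not_gr0)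
  qed
  then show pos: "r c b > 0 \<longleftrightarrow> b < card {b. r c b > 0}" for c b
    by blast
  have mem_fst: "c \<in> fst ` cells r \<longleftrightarrow> (\<exists>b. r c b > 0)" for c
    by (auto simp: cells_def image_iff)
  have "fst ` cells r = {..<card (fst ` cells r)}"
  proof (rule down_closed_eq_lessThan)
    have "r c b > 0" if "r (Suc c) b > 0" for c b
      using assms(1) that unfolding strict_heights_def by (metis diff_0_eq_0 le_zero_eq not_gr0)
    then show "Suc c \<in> fst ` cells r \<Longrightarrow> c \<in> fst ` cells r" for c
      unfolding mem_fst by blast
  qed (use assms(2) in simp)
  moreover have "c \<in> fst ` cells r \<longleftrightarrow> card {b. r c b > 0} > 0" for c
    by (metis mem_fst pos gr_zeroI less_nat_zero_code)
  ultimately show rows: "card {b. r c b > 0} > 0 \<longleftrightarrow> c < card (fst ` cells r)" for c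
    by blast
  have "(c, b) \<in> cells r \<longleftrightarrow> r c b > 0" for c b
    by (simp add: cells_def)
  then have "(c, b) \<in> cells r \<longleftrightarrow> c < card (fst ` cells r) \<and> b < card {b. r c b > 0}" for c b
    by (metis pos rows gr_zeroI less_nat_zero_code)
  then show "cells r = (SIGMA c:{..<card (fst ` cells r)}. {..<card {b. r c b > 0}})"
    by (intro set_eqI) (simp only: split_paired_all mem_Sigma_iff lessThan_iff)
qed

lemma plane_array_in_strict_plane_partitions:
  assumes "r \<in> heights_of p h k"
  shows "plane_array r \<in> strict_plane_partitions p h k"
proof -
  define l where "l c = card {b. r c b > 0}" for c
  \<comment> \<open>The shape is the sequence of row lengths of the support, reindexed from
    1.\<close>
  define \<beta> where "\<beta> i = (if i = 0 then 0 else l (i - 1))" for i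
  from assms have str: "strict_heights r" and fin: "finite (cells r)"
    and k: "card (fst ` cells r) = k" and h: "card (cells r) = h"
    and p: "(\<Sum>(c, b)\<in>cells r. r c b) = p"
    by (auto simp: heights_of_def)
  note cells = cells_strict_heights[OF str fin, folded l_def, unfolded k]
  have \<beta>_Suc [simp]: "\<beta> (Suc c) = l c" for c
    by (simp add: \<beta>_def)
  have l_dec: "l (Suc c) < l c" if "Suc c < k" for c
  proof -
    have "l (Suc c) > 0"
      using cells(3) that by blast
    \<comment> \<open>This is the last cell of row \<open>Suc c\<close>. By the third condition of
      \<open>strict_heights\<close>, contraposed, row \<open>c\<close> is positive one column
      further right, hence strictly longer.\<close>
    then have "r (Suc c) (l (Suc c) - 1) > 0"
      using cells(2) by simp
    then have "r c (Suc (l (Suc c) - 1)) > 0"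
      using str unfolding strict_heights_def by (metis not_gr_zero)
    then show ?thesis
      using cells(2) \<open>l (Suc c) > 0\<close> by simp
  qed
  have l_zero: "l c = 0" if "\<not> c < k" for c
    using cells(3)[of c] that by simp
  have "h = (\<Sum>c<k. l c)"
    using cells(1) by (simp flip: h)
  then have "(\<Sum>i=1..k. \<beta> i) = h"
    by (simp add: sum.atLeast1_atMost_eq)
  moreover have "\<beta> i = 0" if "i \<notin> {1..k}" for i
    using that l_zero[of "i - 1"] by (auto simp: \<beta>_def)
  moreover have "\<beta> i > 0" if "i \<in> {1..k}" for i
    using that cells(3)[of "i - 1"] by (auto simp: \<beta>_def)
  moreover have "\<beta> (i + 1) < \<beta> i" if "i \<in> {1..<k}" for i
    using that l_dec[of "i - 1"] by (auto simp: \<beta>_def)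
  ultimately have "\<beta> \<in> strict_shapes h k"
    by (simp add: strict_shapes_def)
  moreover have "plane_array r \<in> strict_plane_partitions_of_shape p k \<beta>"
    unfolding strict_plane_partitions_of_shape_def
  proof (intro CollectI conjI)
    show "\<forall>i j. \<not> (i \<in> {1..k} \<and> j \<in> {1..\<beta> i}) \<longrightarrow> plane_array r i j = 0"
    proof (intro allI impI)
      fix i j
      assume *: "\<not> (i \<in> {1..k} \<and> j \<in> {1..\<beta> i})"
      show "plane_array r i j = 0"
      proof (cases "i = 0 \<or> j = 0")
        case False
        then obtain c b where "i = Suc c" "j = Suc b"
          by (metis not0_implies_Suc)
        with * have "\<not> (c < k \<and> b < l c)"
          by auto
        then have "\<not> r c b > 0"
          using cells(2,3) by (metis gr_zeroI less_zeroE)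
        then show ?thesis
          by (simp add: \<open>i = Suc c\<close> \<open>j = Suc b\<close>)
      qed (simp add: plane_array_def)
    qed
    show "\<forall>i\<in>{1..k}. \<forall>j\<in>{1..\<beta> i}. plane_array r i j > 0"
      using cells(2) by (auto simp: plane_array_def \<beta>_def)
    show "\<forall>i\<in>{1..k}. \<forall>j\<in>{1..<\<beta> i}. plane_array r i j > plane_array r i (j + 1)"
    proof (intro ballI)
      fix i j
      assume ij: "i \<in> {1..k}" "j \<in> {1..<\<beta> i}"
      then obtain c b where cb: "i = Suc c" "j = Suc b"
        by (metis atLeastAtMost_iff atLeastLessThan_iff not0_implies_Suc not_one_le_zero)
      with ij have "r c b > 0"
        using cells(2) by simp
      moreover have "r c (Suc b) \<le> r c b - 1"
        using str by (simp add: strict_heights_def)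
      ultimately show "plane_array r i j > plane_array r i (j + 1)"
        by (simp add: cb)
    qed
    show "\<forall>i\<in>{1..<k}. \<forall>j\<in>{1..\<beta> (i + 1)}. plane_array r i j > plane_array r (i + 1) j"
    proof (intro ballI)
      fix i j
      assume ij: "i \<in> {1..<k}" "j \<in> {1..\<beta> (i + 1)}"
      then obtain c b where cb: "i = Suc c" "j = Suc b"
        by (metis atLeastAtMost_iff atLeastLessThan_iff not0_implies_Suc not_one_le_zero)
      with ij have "r (Suc c) b > 0"
        using cells(2) by simp
      moreover have "r (Suc c) b \<le> r c b - 1"
        using str by (simp add: strict_heights_def)
      ultimately show "plane_array r i j > plane_array r (i + 1) j"
        by (simp add: cb)
    qed
    have "p = (\<Sum>c<k. \<Sum>b<l c. r c b)"
      unfolding p[symmetric] cells(1) by (rule sum.Sigma[symmetric]) auto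
    then show "(\<Sum>i=1..k. \<Sum>j=1..\<beta> i. plane_array r i j) = int p"
      by (simp add: sum.atLeast1_atMost_eq)
  qed
  ultimately show ?thesis
    by (auto simp: strict_plane_partitions_def)
qed

text \<open>The heights are the entries with both indices shifted down. Converting with
  \<open>nat\<close> loses nothing, since entries are positive on the shape and 0 elsewhere.\<close>

lemma strict_plane_partitions_plane_array:
  assumes "\<rho> \<in> strict_plane_partitions p h k"
  shows "\<exists>r\<in>heights_of p h k. \<rho> = plane_array r"
proof -
  from assms obtain \<beta> where \<beta>: "\<beta> \<in> strict_shapes h k"
    and \<rho>: "\<rho> \<in> strict_plane_partitions_of_shape p k \<beta>"
    by (auto simp: strict_plane_partitions_def)
  define r where "r c b = nat (\<rho> (Suc c) (Suc b))" for c b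
  have \<beta>_pos: "\<beta> (Suc c) > 0" if "c < k" for c
    using \<beta> that by (auto simp: strict_shapes_def)
  have \<beta>_zero: "\<beta> (Suc c) = 0" if "\<not> c < k" for c
    using \<beta> that by (auto simp: strict_shapes_def)
  have \<beta>_dec: "\<beta> (Suc (Suc c)) < \<beta> (Suc c)" if "Suc c < k" for c
    using \<beta> that by (auto simp: strict_shapes_def)
  have zero: "\<rho> i j = 0" if "\<not> (i \<in> {1..k} \<and> j \<in> {1..\<beta> i})" for i j
    using \<rho> that unfolding strict_plane_partitions_of_shape_def by blast
  have pos: "\<rho> (Suc c) (Suc b) > 0" if "c < k" "b < \<beta> (Suc c)" for c b
    using \<rho> that by (auto simp: strict_plane_partitions_of_shape_def)
  have row: "\<rho> (Suc c) (Suc (Suc b)) < \<rho> (Suc c) (Suc b)" if "c < k" "Suc b < \<beta> (Suc c)" for c b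
    using \<rho> that by (auto simp: strict_plane_partitions_of_shape_def)
  have col: "\<rho> (Suc (Suc c)) (Suc b) < \<rho> (Suc c) (Suc b)" if "Suc c < k" "b < \<beta> (Suc (Suc c))" for c b
    using \<rho> that by (auto simp: strict_plane_partitions_of_shape_def)
  \<comment> \<open>Positivity recovers the shape, so the support of \<open>r\<close> is the diagram
    of \<open>\<beta>\<close>.\<close>
  have r_pos: "r c b > 0 \<longleftrightarrow> c < k \<and> b < \<beta> (Suc c)" for c b
    using pos[of c b] zero[of "Suc c" "Suc b"] by (force simp: r_def)
  have int_r: "int (r c b) = \<rho> (Suc c) (Suc b)" for c b
    using pos[of c b] zero[of "Suc c" "Suc b"] by (force simp: r_def)
  have array: "\<rho> = plane_array r"
  proof (intro ext)
    fix i j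
    show "\<rho> i j = plane_array r i j"
      using zero[of i j] by (auto simp: plane_array_def int_r)
  qed
  have cells: "cells r = (SIGMA c:{..<k}. {..<\<beta> (Suc c)})"
    using r_pos by (auto simp: cells_def)
  have "strict_heights r"
    unfolding strict_heights_def
  proof (intro allI conjI impI)
    fix c b
    show "r c (Suc b) \<le> r c b - 1"
    proof (cases "r c (Suc b) > 0")
      case True
      then have "int (r c (Suc b)) < int (r c b)"
        unfolding int_r r_pos by (intro row) auto
      then show ?thesis
        by simp
    qed simp
    show "r (Suc c) b \<le> r c b - 1"
    proof (cases "r (Suc c) b > 0")
      case True
      then have "int (r (Suc c) b) < int (r c b)"
        unfolding int_r r_pos by (intro col) auto
      then show ?thesis
        by simp
    qed simp
    \<comment> \<open>If \<open>r (Suc c) b\<close> were positive, then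
      \<open>b < \<beta> (Suc (Suc c)) < \<beta> (Suc c)\<close>, so column \<open>Suc b\<close>
      would still lie in row \<open>c\<close> of the support.\<close>
    show "r (Suc c) b = 0" if "r c (Suc b) = 0"
      using r_pos[of c "Suc b"] r_pos[of "Suc c" b] \<beta>_dec[of c] that by fastforce
  qed
  moreover have "finite (cells r)"
    by (simp add: cells)
  moreover have "(\<Sum>(c, b)\<in>cells r. r c b) = p"
  proof -
    have "(\<Sum>(c, b)\<in>cells r. r c b) = (\<Sum>c<k. \<Sum>b<\<beta> (Suc c). r c b)"
      unfolding cells by (rule sum.Sigma[symmetric]) auto
    also have "int \<dots> = (\<Sum>i=1..k. \<Sum>j=1..\<beta> i. \<rho> i j)"
      by (simp add: sum.atLeast1_atMost_eq int_r)
    also have "\<dots> = int p"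
      using \<rho> by (simp add: strict_plane_partitions_of_shape_def)
    finally show ?thesis
      by (simp only: of_nat_eq_iff)
  qed
  moreover have "card (cells r) = h"
    using \<beta> by (simp add: cells strict_shapes_def sum.atLeast1_atMost_eq)
  moreover have "fst ` cells r = {..<k}"
    using \<beta>_pos by (force simp: cells image_iff)
  ultimately show ?thesis
    using array by (intro bexI[of _ r]) (simp_all add: heights_of_def)
qed

lemma bij_betw_heights_strict_plane_partitions:
  "bij_betw plane_array (heights_of p h k) (strict_plane_partitions p h k)"
proof (rule bij_betwI')
  show "plane_array r = plane_array s \<longleftrightarrow> r = s" for r s
    by (metis plane_array_Suc of_nat_eq_iff ext)
qed (fact plane_array_in_strict_plane_partitions strict_plane_partitions_plane_array)+

theorem mainTheorem12:
  fixes p h k :: nat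
  assumes "p > 0" and "h > 0" and "k > 0"
  shows "\<exists>f. bij_betw f (strict_plane_partitions p h k)
           {J :: 'k::field_char_0 polynomial3 set.
              monomial_ideal J \<and> stable J \<and> finite (terms_outside J) \<and>
              bar_list (terms_outside J) = (p, h, k)}"
  \<comment> \<open>Both bijections start from \<open>heights_of p h k\<close>, so the one onto
    plane partitions is inverted before composing.\<close>
  using bij_betw_trans[OF bij_betw_inv_into[OF bij_betw_heights_strict_plane_partitions]
      bij_betw_heights_ideals] by blast

end
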